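(* Let $\mathcal O$ be the DL-Lite$^{\mathcal H}$ ontology $\{A\sqsubseteq\exists R,\ \exists R^-\sqsubseteq A,\ R^-\sqsubseteq S\}$ for a concept name $A$ and role names $R,S$. Then $\mathcal{L}(\exists,\sqcap)$ does not admit finite characterisations under $\mathcal O$.
   Context: $\mathcal{L}(\exists,\sqcap)[\Sigma_C,\Sigma_R]$ is the set of concepts $C ::= B\mid C\sqcap C\mid\exists T.C$ with $B$ in a finite set $\Sigma_C$ of concept names and $T$ in a finite set $\Sigma_R$ of role names, standard semantics. $\exists T$ abbreviates $\exists T.\top$ and $(R^-)^{\mathcal I}$ is the converse of $R^{\mathcal I}$. DL-Lite$^{\mathcal H}$ extends DL-Lite with role inclusions; $\mathcal I\models\mathcal O$ if $A^{\mathcal I}\subseteq(\exists R)^{\mathcal I}$, $(\exists R^-)^{\mathcal I}\subseteq A^{\mathcal I}$ and $(R^-)^{\mathcal I}\subseteq S^{\mathcal I}$. $C\equiv_{\mathcal O}D$ if $C^{\mathcal I}=D^{\mathcal I}$ for all $\mathcal I\models\mathcal O$. An example for $\mathcal O$ is a finite pointed interpretation $(\mathcal I,d)$ with $\mathcal I\models\mathcal O$, labelled positive or negative; $C$ fits $E=(E^+,E^-)$ if $d\in C^{\mathcal I}$ for positive and $d\notin C^{\mathcal I}$ for negative examples. A finite characterisation of $C$ w.r.t. $\mathcal L$ under $\mathcal O$ is a finite collection $E$ of examples for $\mathcal O$ that $C$ fits such that every $D\in\mathcal L$ fitting $E$ satisfies $C\equiv_{\mathcal O}D$. $\mathcal L$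 admits finite characterisations under $\mathcal O$ if for all finite $\Sigma_C,\Sigma_R$, every $C\in\mathcal L[\Sigma_C,\Sigma_R]$ has such a characterisation w.r.t. $\mathcal L[\Sigma_C,\Sigma_R]$ under $\mathcal O$. *)

theory Defs
  imports Main
begin

text \<open>
  Concept names and role names are the elements of the types \<open>'c\<close> and \<open>'r\<close>. The domain of an
  interpretation is a nonempty set of elements of a type \<open>'d\<close>, so that finite and infinite
  interpretations live in the same type. HOL cannot quantify over types inside a formula, so
  notions that quantify over all interpretations take the universe \<open>'d\<close> as an explicit argument.
  It is meant to be an infinite type: then every finite and every countable interpretation
  occurs up to isomorphism, and by the downward Loewenheim-Skolem theorem no choice of infinite
  universe changes \<open>equiv_under\<close> for a finite ontology.
\<close>

record ('c, 'r, 'd) interp =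
  domain :: "'d set"
  cname_int :: "'c \<Rightarrow> 'd set"
  rname_int :: "'r \<Rightarrow> ('d \<times> 'd) set"

definition is_interp :: "('c, 'r, 'd) interp \<Rightarrow> bool" where
  "is_interp \<I> \<longleftrightarrow>
     domain \<I> \<noteq> {} \<and>
     (\<forall>B. cname_int \<I> B \<subseteq> domain \<I>) \<and>
     (\<forall>T. rname_int \<I> T \<subseteq> domain \<I> \<times> domain \<I>)"


subsection \<open>Concepts of \<open>\<L>(\<exists>,\<sqinter>)\<close>\<close>

datatype (concept_names: 'c, role_names: 'r) concept =
    CName 'c
  | CAnd "('c, 'r) concept" "('c, 'r) concept"
  | CEx 'r "('c, 'r) concept"

fun concept_int :: "('c, 'r, 'd) interp \<Rightarrow> ('c, 'r) concept \<Rightarrow> 'd set" where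
  "concept_int \<I> (CName B) = cname_int \<I> B"
| "concept_int \<I> (CAnd C D) = concept_int \<I> C \<inter> concept_int \<I> D"
| "concept_int \<I> (CEx T C) =
     {d \<in> domain \<I>. \<exists>e \<in> domain \<I>. (d, e) \<in> rname_int \<I> T \<and> e \<in> concept_int \<I> C}"

definition lang_ex_and :: "'c set \<Rightarrow> 'r set \<Rightarrow> ('c, 'r) concept set" where
  "lang_ex_and \<Sigma>\<^sub>C \<Sigma>\<^sub>R = {C. concept_names C \<subseteq> \<Sigma>\<^sub>C \<and> role_names C \<subseteq> \<Sigma>\<^sub>R}"


subsection \<open>DL-Lite with role inclusions\<close>

datatype 'r role = Role 'r | Inv 'r

fun role_int :: "('c, 'r, 'd) interp \<Rightarrow> 'r role \<Rightarrow> ('d \<times> 'd) set" where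
  "role_int \<I> (Role T) = rname_int \<I> T"
| "role_int \<I> (Inv T) = (rname_int \<I> T)\<inverse>"

text \<open>\<open>BEx P\<close> is the unqualified restriction \<open>\<exists>P\<close>, that is \<open>\<exists>P.\<top>\<close>.\<close>

datatype ('c, 'r) basic = BName 'c | BEx "'r role"

fun basic_int :: "('c, 'r, 'd) interp \<Rightarrow> ('c, 'r) basic \<Rightarrow> 'd set" where
  "basic_int \<I> (BName B) = cname_int \<I> B"
| "basic_int \<I> (BEx P) = {d \<in> domain \<I>. \<exists>e \<in> domain \<I>. (d, e) \<in> role_int \<I> P}"

text \<open>\<open>CDisj B1 B2\<close> is the negative inclusion \<open>B1 \<sqsubseteq> \<not> B2\<close>.\<close>

datatype ('c, 'r) axm =
    CIncl "('c, 'r) basic" "('c, 'r) basic"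
  | CDisj "('c, 'r) basic" "('c, 'r) basic"
  | RIncl "'r role" "'r role"

fun sat_axm :: "('c, 'r, 'd) interp \<Rightarrow> ('c, 'r) axm \<Rightarrow> bool" where
  "sat_axm \<I> (CIncl B1 B2) \<longleftrightarrow> basic_int \<I> B1 \<subseteq> basic_int \<I> B2"
| "sat_axm \<I> (CDisj B1 B2) \<longleftrightarrow> basic_int \<I> B1 \<inter> basic_int \<I> B2 = {}"
| "sat_axm \<I> (RIncl P Q) \<longleftrightarrow> role_int \<I> P \<subseteq> role_int \<I> Q"

definition model_of :: "('c, 'r, 'd) interp \<Rightarrow> ('c, 'r) axm set \<Rightarrow> bool" where
  "model_of \<I> \<O> \<longleftrightarrow> is_interp \<I> \<and> (\<forall>\<alpha> \<in> \<O>. sat_axm \<I> \<alpha>)"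

definition equiv_under ::
  "'d itself \<Rightarrow> ('c, 'r) axm set \<Rightarrow> ('c, 'r) concept \<Rightarrow> ('c, 'r) concept \<Rightarrow> bool" where
  "equiv_under (_ :: 'd itself) \<O> C D \<longleftrightarrow>
     (\<forall>\<I> :: ('c, 'r, 'd) interp. model_of \<I> \<O> \<longrightarrow> concept_int \<I> C = concept_int \<I> D)"


subsection \<open>Finite characterisations\<close>

type_synonym ('c, 'r, 'd) pointed = "('c, 'r, 'd) interp \<times> 'd"

definition example_for :: "('c, 'r) axm set \<Rightarrow> ('c, 'r, 'd) pointed \<Rightarrow> bool" where
  "example_for \<O> = (\<lambda>(\<I>, d). model_of \<I> \<O> \<and> finite (domain \<I>) \<and> d \<in> domain \<I>)"

definition fits ::
  "('c, 'r) concept \<Rightarrow> ('c, 'r, 'd) pointed set \<Rightarrow> ('c, 'r, 'd) pointed set \<Rightarrow> bool" where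
  "fits C Epos Eneg \<longleftrightarrow>
     (\<forall>(\<I>, d) \<in> Epos. d \<in> concept_int \<I> C) \<and> (\<forall>(\<I>, d) \<in> Eneg. d \<notin> concept_int \<I> C)"

definition finite_characterisation ::
  "('c, 'r) axm set \<Rightarrow> ('c, 'r) concept set \<Rightarrow> ('c, 'r) concept \<Rightarrow>
   ('c, 'r, 'd) pointed set \<Rightarrow> ('c, 'r, 'd) pointed set \<Rightarrow> bool" where
  "finite_characterisation \<O> L C Epos Eneg \<longleftrightarrow>
     finite Epos \<and> finite Eneg \<and> (\<forall>e \<in> Epos \<union> Eneg. example_for \<O> e) \<and>
     fits C Epos Eneg \<and>
     (\<forall>D \<in> L. fits D Epos Eneg \<longrightarrow> equiv_under TYPE('d) \<O> C D)"

definition admits_finite_characterisations ::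
  "'d itself \<Rightarrow> ('c set \<Rightarrow> 'r set \<Rightarrow> ('c, 'r) concept set) \<Rightarrow> ('c, 'r) axm set \<Rightarrow> bool" where
  "admits_finite_characterisations (_ :: 'd itself) \<L> \<O> \<longleftrightarrow>
     (\<forall>\<Sigma>\<^sub>C \<Sigma>\<^sub>R. finite \<Sigma>\<^sub>C \<longrightarrow> finite \<Sigma>\<^sub>R \<longrightarrow>
        (\<forall>C \<in> \<L> \<Sigma>\<^sub>C \<Sigma>\<^sub>R. \<exists>Epos Eneg :: ('c, 'r, 'd) pointed set.
           finite_characterisation \<O> (\<L> \<Sigma>\<^sub>C \<Sigma>\<^sub>R) C Epos Eneg))"

end

theory Submission
  imports Defs
begin

text \<open>
  The concept \<open>A\<close> has no finite characterisation. In a finite model of the ontology, an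
  infinite \<open>R\<close>-path starting in \<open>A\<close> runs into a cycle, and the inverse of this cycle is an
  \<open>S\<close>-cycle inside \<open>A\<close>; hence \<open>A\<close> and \<open>A \<sqinter> \<exists>R\<^sup>n.\<exists>S\<^sup>n\<^sup>+\<^sup>1.A\<close> agree at a given point for all
  large \<open>n\<close>, and some \<open>n\<close> serves for all of finitely many examples. In the infinite model with
  \<open>R\<close> the successor relation on the natural numbers, \<open>S\<close> its converse and \<open>A\<close> everywhere true,
  the two concepts differ at \<open>0\<close>.
\<close>

abbreviation CEx_pow :: "'r \<Rightarrow> nat \<Rightarrow> ('c, 'r) concept \<Rightarrow> ('c, 'r) concept" where
  "CEx_pow T n \<equiv> CEx T ^^ n"

lemma concept_names_CEx_pow: "concept_names (CEx_pow T n C) = concept_names C"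
  by (induction n) auto

lemma role_names_CEx_pow: "role_names (CEx_pow T n C) \<subseteq> insert T (role_names C)"
  by (induction n) auto

definition backtrack_ontology :: "'c \<Rightarrow> 'r \<Rightarrow> 'r \<Rightarrow> ('c, 'r) axm set" where
  "backtrack_ontology A R S =
     {CIncl (BName A) (BEx (Role R)), CIncl (BEx (Inv R)) (BName A), RIncl (Inv R) (Role S)}"

text \<open>The chain has one more \<open>S\<close>-step than \<open>R\<close>-steps: retracing the
  \<open>R\<close>-path by its inverse edges alone allows only \<open>n\<close> steps back.\<close>

definition backtrack_concept :: "'c \<Rightarrow> 'r \<Rightarrow> 'r \<Rightarrow> nat \<Rightarrow> ('c, 'r) concept" where
  "backtrack_concept A R S n =
     CAnd (CName A) (CEx_pow R n (CEx_pow S (Suc n) (CName A)))"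

lemma backtrack_concept_in_lang: "backtrack_concept A R S n \<in> lang_ex_and {A} {R, S}"
  using role_names_CEx_pow[of n R "CEx_pow S (Suc n) (CName A)"]
    role_names_CEx_pow[of "Suc n" S "CName A"]
  by (auto simp del: funpow.simps
      simp: backtrack_concept_def lang_ex_and_def concept_names_CEx_pow)

text \<open>The path is a total function on the naturals, so reversed paths such as
  \<open>p (k - i)\<close> with truncated subtraction are instances.\<close>

lemma concept_int_CEx_pow_path:
  assumes "\<And>i. i < n \<Longrightarrow> (p i, p (Suc i)) \<in> rname_int \<I> T"
    and "\<And>i. p i \<in> domain \<I>" and "p n \<in> concept_int \<I> C"
  shows "p 0 \<in> concept_int \<I> (CEx_pow T n C)"
  using assms
proof (induction n arbitrary: p)
  case (Suc n)
  have "p (Suc 0) \<in> concept_int \<I> (CEx_pow T n C)"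
    using Suc.IH[of "\<lambda>i. p (Suc i)"] Suc.prems by auto
  then show ?case
    using Suc.prems(1)[of 0] Suc.prems(2) by auto
qed simp

text \<open>Phrased with a filter so that the bounds for finitely many examples combine into a
  single \<open>n\<close>.\<close>

lemma backtrack_concept_eventually:
  assumes "model_of \<I> (backtrack_ontology A R S)" and fin: "finite (domain \<I>)"
    and "d \<in> cname_int \<I> A"
  shows "\<forall>\<^sub>F n in sequentially. d \<in> concept_int \<I> (backtrack_concept A R S n)"
proof -
  have A_dom: "cname_int \<I> A \<subseteq> domain \<I>"
    and A_R: "cname_int \<I> A \<subseteq> {d \<in> domain \<I>. \<exists>e \<in> domain \<I>. (d, e) \<in> rname_int \<I> R}"
    and R_A: "{d \<in> domain \<I>. \<exists>e \<in> domain \<I>. (e, d) \<in> rname_int \<I> R} \<subseteq> cname_int \<I> A"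
    and R_S: "(rname_int \<I> R)\<inverse> \<subseteq> rname_int \<I> S"
    using assms(1) by (auto simp: model_of_def is_interp_def backtrack_ontology_def)
  have "\<exists>e \<in> cname_int \<I> A. (x, e) \<in> rname_int \<I> R" if "x \<in> cname_int \<I> A" for x
    using that A_R R_A by blast
  then obtain g where g: "\<And>x. x \<in> cname_int \<I> A \<Longrightarrow> g x \<in> cname_int \<I> A \<and> (x, g x) \<in> rname_int \<I> R"
    by metis
  \<comment> \<open>Iterating one fixed successor function makes a single repeated value force
    periodicity from there on.\<close>
  define p where "p i = (g ^^ i) d" for i
  have p_A: "p i \<in> cname_int \<I> A" for i
    by (induction i) (use assms(3) g in \<open>auto simp: p_def\<close>)
  have p_R: "(p i, p (Suc i)) \<in> rname_int \<I> R" for i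
    using g[OF p_A[of i]] by (simp add: p_def)
  have p_dom: "p i \<in> domain \<I>" for i
    using p_A A_dom by blast
  \<comment> \<open>The path is walked backwards, inverse \<open>R\<close>-edges being
    \<open>S\<close>-edges; \<open>m \<le> k\<close> keeps the index from being truncated at
    0.\<close>
  have S_pow: "p k \<in> concept_int \<I> (CEx_pow S m (CName A))" if "m \<le> k" for k m
  proof -
    have "(p (k - i), p (k - Suc i)) \<in> rname_int \<I> S" if "i < m" for i
      using p_R[of "k - Suc i"] R_S that \<open>m \<le> k\<close> by (auto simp: Suc_diff_Suc)
    then show ?thesis
      using concept_int_CEx_pow_path[of m "\<lambda>i. p (k - i)" \<I> S "CName A"] p_dom p_A by simp
  qed
  have "\<not> inj p"
    using fin p_dom by (meson finite_imageD finite_subset image_subsetI infinite_UNIV_nat)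
  then obtain i j where ij: "i < j" "p i = p j"
    by (metis injI linorder_neqE_nat)
  have period: "p (n + (j - i)) = p n" if "i \<le> n" for n
  proof -
    have shift: "p (k + l) = (g ^^ k) (p l)" for k l
      by (simp add: p_def funpow_add)
    have "p (n + (j - i)) = p ((n - i) + j)" "p n = p ((n - i) + i)"
      using that ij(1) by simp_all
    then show ?thesis
      using ij(2) by (metis shift)
  qed
  have periods: "p (n + m * (j - i)) = p n" if "i \<le> n" for n m
  proof (induction m)
    case (Suc m)
    then show ?case
      using period[of "n + m * (j - i)"] that by (simp add: ac_simps)
  qed simp
  have "d \<in> concept_int \<I> (backtrack_concept A R S n)" if "i \<le> n" for n
  proof -
    \<comment> \<open>Going round the cycle \<open>Suc n\<close> times gives \<open>p n\<close> a
      second index large enough for \<open>Suc n\<close> steps back.\<close>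
    have "Suc n \<le> n + Suc n * (j - i)"
      using ij(1) by (cases "j - i") auto
    then have "p n \<in> concept_int \<I> (CEx_pow S (Suc n) (CName A))"
      using S_pow periods[OF that] by metis
    then have "p 0 \<in> concept_int \<I> (CEx_pow R n (CEx_pow S (Suc n) (CName A)))"
      using p_R p_dom by (rule concept_int_CEx_pow_path[rotated 2])
    then show ?thesis
      using assms(3) by (simp add: backtrack_concept_def p_def)
  qed
  then show ?thesis
    by (auto simp: eventually_sequentially)
qed

lemma backtrack_concept_not_equiv:
  fixes A :: 'c and R S :: 'r
  assumes "infinite (UNIV :: 'd set)" and "R \<noteq> S"
  shows "\<not> equiv_under TYPE('d) (backtrack_ontology A R S) (CName A) (backtrack_concept A R S n)"
proof
  assume equiv: "equiv_under TYPE('d) (backtrack_ontology A R S) (CName A) (backtrack_concept A R S n)"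
  obtain f :: "nat \<Rightarrow> 'd" where f: "inj f"
    using infinite_countable_subset[OF assms(1)] by blast
  \<comment> \<open>A copy of the naturals inside the universe. Every role name other than
    \<open>R\<close> gets the predecessor relation; for \<open>S\<close> this needs
    \<open>R \<noteq> S\<close>.\<close>
  define \<I> :: "('c, 'r, 'd) interp" where
    "\<I> = \<lparr>domain = range f, cname_int = (\<lambda>_. range f),
          rname_int = (\<lambda>T. if T = R then {(f i, f (Suc i)) | i. True}
                           else {(f (Suc i), f i) | i. True})\<rparr>"
  have "model_of \<I> (backtrack_ontology A R S)"
    using assms(2) by (auto simp: model_of_def is_interp_def backtrack_ontology_def \<I>_def)
  then have "f 0 \<in> concept_int \<I> (backtrack_concept A R S n)"
    using equiv by (auto simp: equiv_under_def \<I>_def)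
  \<comment> \<open>\<open>R\<close> is functional here, so the endpoint of an \<open>R\<close>-path
    is forced.\<close>
  moreover have R_pow: "f (k + m) \<in> concept_int \<I> C"
    if "f k \<in> concept_int \<I> (CEx_pow R m C)" for k m C
    using that
  proof (induction m arbitrary: k)
    case (Suc m)
    then have "f (Suc k) \<in> concept_int \<I> (CEx_pow R m C)"
      by (auto simp: \<I>_def inj_eq[OF f])
    from Suc.IH[OF this] show ?case
      by simp
  qed simp
  \<comment> \<open>Each \<open>S\<close>-step lowers the index by one, and \<open>f 0\<close> has
    no \<open>S\<close>-successor.\<close>
  moreover have S_pow: "m \<le> k" if "f k \<in> concept_int \<I> (CEx_pow S m C)" for k m C
    using that
  proof (induction m arbitrary: k)
    case (Suc m)
    then obtain l where "k = Suc l" "f l \<in> concept_int \<I> (CEx_pow S m C)"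
      using assms(2) by (auto simp: \<I>_def inj_eq[OF f])
    with Suc.IH show ?case
      by simp
  qed simp
  ultimately have "Suc n \<le> 0 + n"
    unfolding backtrack_concept_def concept_int.simps by blast
  then show False
    by simp
qed

theorem theorem17:
  fixes A :: 'c and R S :: 'r
  assumes "infinite (UNIV :: 'd set)"
    and "R \<noteq> S"
  shows "\<not> admits_finite_characterisations TYPE('d) lang_ex_and
           {CIncl (BName A) (BEx (Role R)),
            CIncl (BEx (Inv R)) (BName A),
            RIncl (Inv R) (Role S)}"
proof
  let ?O = "backtrack_ontology A R S"
  assume "admits_finite_characterisations TYPE('d) lang_ex_and
           {CIncl (BName A) (BEx (Role R)),
            CIncl (BEx (Inv R)) (BName A),
            RIncl (Inv R) (Role S)}"
  then have adm: "admits_finite_characterisations TYPE('d) lang_ex_and ?O"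
    by (simp only: backtrack_ontology_def)
  have "CName A \<in> lang_ex_and {A} {R, S}"
    by (simp add: lang_ex_and_def)
  with adm obtain Epos Eneg :: "('c, 'r, 'd) pointed set" where
    char: "finite_characterisation ?O (lang_ex_and {A} {R, S}) (CName A) Epos Eneg"
    unfolding admits_finite_characterisations_def by (meson finite.emptyI finite.insertI)
  then have fin: "finite Epos"
    and ex: "\<And>e. e \<in> Epos \<Longrightarrow> example_for ?O e"
    and fit: "fits (CName A) Epos Eneg"
    and uniq: "\<And>D. D \<in> lang_ex_and {A} {R, S} \<Longrightarrow> fits D Epos Eneg
                 \<Longrightarrow> equiv_under TYPE('d) ?O (CName A) D"
    by (auto simp: finite_characterisation_def)
  have "\<forall>\<^sub>F n in sequentially. snd e \<in> concept_int (fst e) (backtrack_concept A R S n)"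
    if "e \<in> Epos" for e
    using ex[OF that] fit that
    by (intro backtrack_concept_eventually) (auto simp: example_for_def fits_def)
  then have "\<forall>\<^sub>F n in sequentially.
      \<forall>e\<in>Epos. snd e \<in> concept_int (fst e) (backtrack_concept A R S n)"
    using fin by (simp add: eventually_ball_finite)
  then obtain n where "\<forall>e\<in>Epos. snd e \<in> concept_int (fst e) (backtrack_concept A R S n)"
    by (auto simp: eventually_sequentially)
  \<comment> \<open>The conjunct \<open>CName A\<close> takes care of the negative examples: they
    already fail \<open>A\<close>.\<close>
  then have "fits (backtrack_concept A R S n) Epos Eneg"
    using fit by (fastforce simp: fits_def backtrack_concept_def)
  with uniq[OF backtrack_concept_in_lang]
  have "equiv_under TYPE('d) ?O (CName A) (backtrack_concept A R S n)" .
  with backtrack_concept_not_equiv[OF assms, of A n] show False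
    by blast
qed

end
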